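(* For integers $p\geq1$, $q\geq2$ and $\sigma_1,\sigma_2\in\{\pm1\}$, the linear Euler $\tilde S$-sums $\tilde S_{p,q}^{\sigma_1,\sigma_2}=\sum_{n=1}^\infty\sigma_2^{n-1}\frac{h_n^{(p)}(\sigma_1)}{n^q}$ satisfy \begin{align*} \sigma_2(-1)^p\delta_{\sigma_1}^{p+q}\,\tilde S_{p,q}^{\sigma_1,\sigma_2} &=-(1+(-1)^q)\,\tilde t(p;\sigma_1)\zeta(q;\sigma_2)-\binom{p+q-1}{p-1}\tilde t(p+q;\sigma_1)\\ &\quad+\sum_{k=1}^p\delta_{\sigma_1\sigma_2}^{k-1}\binom{p+q-k-1}{q-1} \tilde t(p+q-k;\sigma_2)\,\tilde t(k;\sigma_1\sigma_2)\\ &\quad+2\sum_{j=1}^{\lfloor q/2\rfloor}\binom{p+q-2j-1}{p-1} \tilde t(p+q-2j;\sigma_1)\,\zeta(2j;\sigma_1\sigma_2), \end{align*} where $\zeta(1;1):=0$ and $\tilde t(1;1):=2\ln 2$ wherever they occur.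
   Context: For $\sigma\in\{\pm1\}$ and integers $n\ge0$, $r\ge1$: $h_n^{(r)}(\sigma)=\sum_{k=1}^n\frac{\sigma^{k-1}}{(k-1/2)^r}$ (so $h_0^{(r)}(\sigma)=0$). For $(s,\sigma)\ne(1,1)$: $\zeta(s;\sigma)=\sum_{n\ge1}\frac{\sigma^n}{n^s}$ and $\tilde t(s;\sigma)=\sum_{n\ge1}\frac{\sigma^n}{(n-1/2)^s}$. Also $\delta_\sigma^k=1-\sigma(-1)^k$ for $\sigma=\pm1$ and integer $k$. *)

theory Defs
  imports "HOL-Analysis.Analysis"
begin

text \<open>
  The signs \<open>\<sigma>\<close> are reals, constrained to \<open>{1, -1}\<close> where they are used. All series are ordinary
  (ordered, possibly only conditionally convergent) sums over \<open>m \<ge> 1\<close>, written with \<open>m = Suc n\<close>.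
\<close>

definition h_sum :: "nat \<Rightarrow> real \<Rightarrow> nat \<Rightarrow> real" where
  "h_sum r \<sigma> n = (\<Sum>k=1..n. \<sigma> ^ (k - 1) / (real k - 1/2) ^ r)"

text \<open>
  The series for \<open>(s, \<sigma>) = (1, 1)\<close> diverges; there the regularized values \<open>0\<close> and \<open>2 ln 2\<close>
  are prescribed by convention.
\<close>

definition alt_zeta :: "nat \<Rightarrow> real \<Rightarrow> real" where
  "alt_zeta s \<sigma> = (if s = 1 \<and> \<sigma> = 1 then 0
     else (\<Sum>n. \<sigma> ^ Suc n / real (Suc n) ^ s))"

definition alt_t :: "nat \<Rightarrow> real \<Rightarrow> real" where
  "alt_t s \<sigma> = (if s = 1 \<and> \<sigma> = 1 then 2 * ln 2
     else (\<Sum>n. \<sigma> ^ Suc n / (real (Suc n) - 1/2) ^ s))"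

definition delta_coeff :: "real \<Rightarrow> int \<Rightarrow> real" where
  "delta_coeff \<sigma> k = 1 - \<sigma> * (-1) powi k"

text \<open>The factor \<open>\<sigma>2 ^ n\<close> is \<open>\<sigma>2 ^ (m - 1)\<close> for \<open>m = Suc n\<close>.\<close>

definition euler_S :: "nat \<Rightarrow> nat \<Rightarrow> real \<Rightarrow> real \<Rightarrow> real" where
  "euler_S p q \<sigma>1 \<sigma>2 = (\<Sum>n. \<sigma>2 ^ n * (h_sum p \<sigma>1 (Suc n) / real (Suc n) ^ q))"

end

theory Submission
  imports Defs
begin

text \<open>
  For half-integers \<open>b = j - 1/2\<close> and integers \<open>n \<noteq> 0\<close> put \<open>a = n - b\<close> and sum
  \<open>\<sigma>2^n \<sigma>1^(n - j) / (a^p n^q)\<close> over \<open>1 \<le> j \<le> J\<close> and all \<open>n \<noteq> 0\<close>, with \<open>n\<close> and \<open>- n\<close> taken together.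
  For fixed \<open>j\<close>, partial fractions in \<open>n\<close> split the signs as well, so every row is a combination of
  values of \<open>alt_t\<close> and \<open>alt_zeta\<close> with coefficients \<open>\<sigma>^j / b^r\<close>; these give the right-hand side.
  For fixed \<open>n\<close>, the reflection \<open>a \<mapsto> - a\<close> reduces the column to \<open>h_sum p \<sigma>1 n\<close>, plus
  \<open>h_sum p \<sigma>1 J\<close>, plus two windows of \<open>n\<close> consecutive terms \<open>\<sigma>1^i / (i + 1/2)^p\<close> moving off to infinity.
  By Cauchy-Schwarz a window is \<open>O(sqrt n)\<close> uniformly in \<open>J\<close>, so by Tannery's theorem the windows
  vanish as \<open>J \<rightarrow> \<infinity>\<close>. The only divergent quantity, \<open>h_sum 1 1 J\<close> for \<open>(p, \<sigma>1) = (1, 1)\<close>, has coefficient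
  proportional to \<open>alt_zeta q (\<sigma>1 * \<sigma>2) - alt_zeta q \<sigma>2 = 0\<close>; hence the convention for \<open>alt_t 1 1\<close> is
  immaterial.
\<close>

section \<open>Partial fractions with two poles\<close>

text \<open>If \<open>x\<close> is the success probability in independent trials, the two summands
  are the probabilities that success number \<open>n + 1\<close> precedes failure number
  \<open>m + 1\<close>, and the reverse. Over a ring this becomes an induction on \<open>n\<close>
  by Pascal's rule.\<close>

lemma chaundy_bullard:
  fixes x y :: "'a :: comm_ring_1"
  assumes "x + y = 1"
  shows "x ^ Suc n * (\<Sum>i\<le>m. of_nat ((n + i) choose i) * y ^ i)
       + y ^ Suc m * (\<Sum>i\<le>n. of_nat ((m + i) choose i) * x ^ i) = 1"
proof (induction n)
  case 0
  have "x = 1 - y" using assms by (simp add: algebra_simps)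
  then have "x * (\<Sum>i\<le>m. y ^ i) = 1 - y ^ Suc m"
    by (simp only: one_diff_power_eq lessThan_Suc_atMost)
  then show ?case by simp
next
  case (Suc n)
  define S where "S k = (\<Sum>i\<le>m. of_nat ((k + i) choose i) * y ^ i)" for k
  define c :: 'a where "c = of_nat ((Suc n + m) choose m)"
  \<comment> \<open>Pascal's rule on each coefficient; re-indexing the part with lower index
    \<open>i - 1\<close> produces the factor \<open>y\<close> and the strict bound
    \<open>i < m\<close>.\<close>
  have shift: "(\<Sum>i\<le>m. of_nat ((Suc k + i) choose i) * y ^ i)
      = S k + y * (\<Sum>i<m. of_nat ((Suc k + i) choose i) * y ^ i)" for k
  proof (cases m)
    case (Suc l)
    have "(\<Sum>i\<le>Suc l. of_nat ((Suc k + i) choose i) * y ^ i)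
        = 1 + (\<Sum>i\<le>l. of_nat ((Suc k + Suc i) choose Suc i) * y ^ Suc i)"
      by (subst sum.atMost_Suc_shift) simp
    also have "(\<Sum>i\<le>l. of_nat ((Suc k + Suc i) choose Suc i) * y ^ Suc i)
        = (\<Sum>i\<le>l. of_nat ((k + Suc i) choose Suc i) * y ^ Suc i)
          + y * (\<Sum>i\<le>l. of_nat ((Suc k + i) choose i) * y ^ i)"
      by (simp add: sum_distrib_left sum.distrib[symmetric] algebra_simps)
    also have "1 + (\<dots>) = S k + y * (\<Sum>i\<le>l. of_nat ((Suc k + i) choose i) * y ^ i)"
      by (simp add: S_def Suc sum.atMost_Suc_shift del: sum.atMost_Suc)
    finally show ?thesis by (simp add: Suc lessThan_Suc_atMost)
  qed (simp add: S_def)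
  have last: "S (Suc n) = (\<Sum>i<m. of_nat ((Suc n + i) choose i) * y ^ i) + c * y ^ m"
    by (simp add: S_def c_def flip: lessThan_Suc_atMost)
  have "S (Suc n) = S n + y * (S (Suc n) - c * y ^ m)"
    using shift[of n] last by (simp add: S_def)
  then have "S (Suc n) - y * S (Suc n) = S n - c * y ^ Suc m"
    by (simp add: algebra_simps)
  moreover have "x * S (Suc n) + y * S (Suc n) = S (Suc n)"
    using assms by (metis distrib_right mult_1)
  ultimately have xS: "x * S (Suc n) = S n - c * y ^ Suc m"
    by (metis eq_diff_eq)
  have "((m + Suc n) choose Suc n) = ((Suc n + m) choose m)"
    by (metis add.commute add_diff_cancel_left' binomial_symmetric le_add1)
  then have "(of_nat ((m + Suc n) choose Suc n) :: 'a) = c"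
    by (simp only: c_def)
  \<comment> \<open>Raising \<open>n\<close> by one thus lowers the first product by
    \<open>c * x ^ Suc n * y ^ Suc m\<close>, which is exactly the new term \<open>i = Suc n\<close>
    of the second.\<close>
  moreover have "x ^ Suc (Suc n) * S (Suc n) = x ^ Suc n * S n - c * x ^ Suc n * y ^ Suc m"
    using xS by (simp only: power_Suc2[of x "Suc n"] mult.assoc) (simp add: algebra_simps)
  ultimately have "x ^ Suc (Suc n) * S (Suc n) + y ^ Suc m * (\<Sum>i\<le>Suc n. of_nat ((m + i) choose i) * x ^ i)
      = x ^ Suc n * S n + y ^ Suc m * (\<Sum>i\<le>n. of_nat ((m + i) choose i) * x ^ i)"
    by (simp only: sum.atMost_Suc) (simp add: algebra_simps)
  then show ?case
    using Suc.IH by (simp only: S_def)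
qed

text \<open>Since \<open>y / b\<close> and \<open>- x / b\<close> add up to 1,
  \<open>chaundy_bullard\<close> applies to them. Dividing it by \<open>x ^ p * y ^ q\<close> turns
  the summands with index \<open>i\<close> into the poles \<open>1 / x ^ (p - i)\<close> and
  \<open>1 / y ^ (q - i)\<close>.\<close>

lemma partial_fraction_two_poles:
  fixes x y b :: "'a :: field"
  assumes "p \<ge> 1" "q \<ge> 1" "x \<noteq> 0" "y \<noteq> 0" "b \<noteq> 0" "y - x = b"
  shows "1 / (x ^ p * y ^ q) =
      (\<Sum>k=1..p. (-1) ^ (p + k) * of_nat ((p + q - k - 1) choose (q - 1)) / (b ^ (p + q - k) * x ^ k))
    + (-1) ^ p * (\<Sum>k=1..q. of_nat ((p + q - k - 1) choose (p - 1)) / (b ^ (p + q - k) * y ^ k))"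
proof -
  obtain m n where p: "p = Suc m" and q: "q = Suc n"
    using assms by (metis Suc_le_D One_nat_def)
  have "y / b + (- x / b) = 1"
    using assms by (simp add: field_simps)
  note cb = chaundy_bullard[OF this, of n m]
  have rev: "(\<Sum>k=1..Suc l. f k) = (\<Sum>i\<le>l. f (Suc l - i))" for l and f :: "nat \<Rightarrow> 'a"
    by (rule sum.reindex_bij_witness[of _ "\<lambda>i. Suc l - i" "\<lambda>k. Suc l - k"]) auto
  have bin: "(p + q - (Suc l - i) - 1 choose l') = (l' + i choose i)"
    if "i \<le> l" "p + q = Suc l + Suc l'" for i l l'
  proof -
    have "p + q - (Suc l - i) - 1 = l' + i" using that by auto
    then show ?thesis using binomial_symmetric[of i "l' + i"] by simp
  qed
  have A: "(y / b) ^ Suc n * (of_nat ((n + i) choose i) * (- x / b) ^ i) / (x ^ p * y ^ q)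
      = (-1) ^ (p + (p - i)) * of_nat ((p + q - (p - i) - 1) choose (q - 1))
        / (b ^ (p + q - (p - i)) * x ^ (p - i))" if "i \<le> m" for i
  proof -
    have 1: "(-1 :: 'a) ^ (p + (p - i)) = (-1) ^ i"
      using that p by (simp add: minus_one_power_iff)
    have 2: "p + q - (p - i) = q + i" "x ^ p = x ^ (p - i) * x ^ i"
      using that p by (auto simp flip: power_add)
    have 3: "(- x / b) ^ i = (-1) ^ i * x ^ i / b ^ i"
      by (metis power_divide power_minus)
    have 4: "(p + q - (p - i) - 1) choose (q - 1) = ((n + i) choose i)"
      using that bin[of i m n] p q by simp
    have 5: "(y / b) ^ Suc n = y ^ q / b ^ q" using q by (simp add: power_divide)
    show ?thesis using assms(3-5)
      unfolding 4 unfolding 1 2 3 5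
      by (simp add: power_add mult_ac)
  qed
  have B: "(- x / b) ^ Suc m * (of_nat ((m + i) choose i) * (y / b) ^ i) / (x ^ p * y ^ q)
      = (-1) ^ p * (of_nat ((p + q - (q - i) - 1) choose (p - 1))
        / (b ^ (p + q - (q - i)) * y ^ (q - i)))" if "i \<le> n" for i
  proof -
    have 2: "p + q - (q - i) = p + i" "y ^ q = y ^ (q - i) * y ^ i"
      using that q by (auto simp flip: power_add)
    have 3: "(- x / b) ^ Suc m = (-1) ^ p * x ^ p / b ^ p"
      using p by (metis power_divide power_minus)
    have 4: "(p + q - (q - i) - 1) choose (p - 1) = ((m + i) choose i)"
      using that bin[of i n m] p q by simp
    have 5: "(y / b) ^ i = y ^ i / b ^ i" by (simp add: power_divide)
    show ?thesis using assms(3-5)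
      unfolding 4 unfolding 2 3 5
      by (simp add: power_add mult_ac)
  qed
  have "1 / (x ^ p * y ^ q) =
     ((y / b) ^ Suc n * (\<Sum>i\<le>m. of_nat ((n + i) choose i) * (- x / b) ^ i)
       + (- x / b) ^ Suc m * (\<Sum>i\<le>n. of_nat ((m + i) choose i) * (y / b) ^ i)) / (x ^ p * y ^ q)"
    using cb by simp
  also have "\<dots> = (\<Sum>i\<le>m. (-1) ^ (p + (p - i)) * of_nat ((p + q - (p - i) - 1) choose (q - 1))
          / (b ^ (p + q - (p - i)) * x ^ (p - i)))
      + (\<Sum>i\<le>n. (-1) ^ p * (of_nat ((p + q - (q - i) - 1) choose (p - 1))
        / (b ^ (p + q - (q - i)) * y ^ (q - i))))"
    unfolding add_divide_distrib sum_distrib_left sum_divide_distrib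
    by (intro arg_cong2[where f = "(+)"] sum.cong refl A B) auto
  finally show ?thesis
    unfolding p q rev by (simp add: sum_distrib_left)
qed

section \<open>Convergence of the signed series\<close>

text \<open>The shift \<open>c = 0\<close> serves \<open>alt_zeta\<close> and \<open>c = 1/2\<close>
  serves \<open>alt_t\<close>. For \<open>s = 1\<close> the series alternates and Leibniz's
  criterion applies; for \<open>s \<ge> 2\<close> the bound \<open>m - c \<ge> (1 - c) * m\<close>
  for \<open>m \<ge> 1\<close> gives a comparison with \<open>1 / m ^ s\<close>.\<close>

lemma summable_sign_power_series:
  fixes c \<sigma> :: real
  assumes "\<sigma> \<in> {1, -1}" "0 \<le> c" "c < 1" "s \<ge> 1" "\<not> (s = 1 \<and> \<sigma> = 1)"
  shows "summable (\<lambda>n. \<sigma> ^ Suc n / (real (Suc n) - c) ^ s)"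
proof (cases "s = 1")
  case True
  then have \<sigma>: "\<sigma> = -1" using assms by auto
  have "summable (\<lambda>n. (-1) ^ n * (1 / (real (Suc n) - c)))"
  proof (rule summable_Leibniz'(1))
    show "(\<lambda>n. 1 / (real (Suc n) - c)) \<longlonglongrightarrow> 0" by real_asymp
  qed (use assms in \<open>auto simp: frac_le\<close>)
  from summable_mult[OF this, of "-1"] show ?thesis
    by (simp add: \<sigma> True)
next
  case False
  with assms have "s \<ge> 2" by simp
  then have "summable (\<lambda>n. inverse (real n ^ s))"
    by (rule inverse_power_summable)
  then have "summable (\<lambda>n. (1 / (1 - c)) ^ s * inverse (real (Suc n) ^ s))"
    by (intro summable_mult) (subst summable_Suc_iff)
  then show ?thesis
  proof (rule summable_comparison_test')
    fix n :: nat
    have "c * 1 \<le> c * real (Suc n)"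
      using assms by (intro mult_left_mono) auto
    then have "(1 - c) * real (Suc n) \<le> real (Suc n) - c"
      by (simp add: algebra_simps)
    then have "((1 - c) * real (Suc n)) ^ s \<le> (real (Suc n) - c) ^ s"
      using assms by (intro power_mono) auto
    then have "1 / (real (Suc n) - c) ^ s \<le> 1 / ((1 - c) * real (Suc n)) ^ s"
      using assms by (intro divide_left_mono mult_pos_pos zero_less_power) auto
    also have "\<dots> = (1 / (1 - c)) ^ s * inverse (real (Suc n) ^ s)"
      unfolding power_mult_distrib power_divide by (simp add: divide_inverse)
    also have "1 / (real (Suc n) - c) ^ s = norm (\<sigma> ^ Suc n / (real (Suc n) - c) ^ s)"
    proof -
      have "\<bar>\<sigma> ^ Suc n\<bar> = 1" using assms by (auto simp: power_abs)
      moreover have "\<bar>(real (Suc n) - c) ^ s\<bar> = (real (Suc n) - c) ^ s"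
        using assms by simp
      ultimately show ?thesis by (simp only: real_norm_def abs_divide)
    qed
    finally show "norm (\<sigma> ^ Suc n / (real (Suc n) - c) ^ s) \<le> (1 / (1 - c)) ^ s * inverse (real (Suc n) ^ s)" .
  qed
qed

section \<open>Half-integer terms and their symmetric sums\<close>

text \<open>Continues the summand of \<open>h_sum\<close>, at \<open>k = i + 1\<close>, to all
  integers, so that the reflection negating \<open>i + 1/2\<close> is available. At
  \<open>i = n - j\<close> the base \<open>i + 1/2\<close> is the difference \<open>a\<close> of the
  double sum.\<close>

definition half_term :: "nat \<Rightarrow> real \<Rightarrow> int \<Rightarrow> real" where
  "half_term r \<sigma> i = \<sigma> powi i / (of_int i + 1/2) ^ r"

lemma half_int_nonzero: "of_int i + 1/2 \<noteq> (0 :: real)"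
proof
  assume "of_int i + 1/2 = (0 :: real)"
  then have "of_int (2 * i + 1) = (0 :: real)" by simp
  then have "2 * i + 1 = 0" by (simp only: of_int_eq_0_iff)
  then show False by presburger
qed

lemma sign_powi_minus: "\<sigma> \<in> {1, -1} \<Longrightarrow> \<sigma> powi (- i) = (\<sigma> powi i :: real)"
  by (auto simp: power_int_minus_one_minus)

text \<open>The indices \<open>i\<close> and \<open>- i - 1\<close> have opposite parity, whence the
  factor \<open>\<sigma>\<close>; their half-integers are negatives of each other, whence
  \<open>(-1) ^ r\<close>.\<close>

lemma half_term_reflect:
  assumes "\<sigma> \<in> {1, -1}"
  shows "half_term r \<sigma> (- i - 1) = (-1) ^ r * \<sigma> * half_term r \<sigma> i"
proof -
  have "\<sigma> powi (- i - 1) = \<sigma> powi (i + 1)"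
    using sign_powi_minus[OF assms, of "i + 1"] by simp
  also have "\<dots> = \<sigma> * \<sigma> powi i" using assms by (auto simp: power_int_add)
  finally have "\<sigma> powi (- i - 1) = \<sigma> * \<sigma> powi i" .
  moreover have "(of_int (- i - 1) + 1/2 :: real) ^ r = (-1) ^ r * (of_int i + 1/2) ^ r"
    by (subst power_mult_distrib[symmetric]) (simp add: algebra_simps)
  ultimately show ?thesis by (simp add: half_term_def minus_one_power_iff)
qed

lemma sum_half_term_nonneg: "(\<Sum>i\<in>{0..<int n}. half_term r \<sigma> i) = h_sum r \<sigma> n"
  unfolding h_sum_def half_term_def
  by (rule sum.reindex_bij_witness[of _ "\<lambda>k. int k - 1" "\<lambda>i. nat (i + 1)"])
     (auto simp: power_int_def nat_add_distrib add.commute)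

lemma sum_half_term_neg:
  assumes "\<sigma> \<in> {1, -1}"
  shows "(\<Sum>i\<in>{- int n..<0}. half_term r \<sigma> i) = (-1) ^ r * \<sigma> * h_sum r \<sigma> n"
  unfolding sum_half_term_nonneg[symmetric] sum_distrib_left
  by (rule sum.reindex_bij_witness[of _ "\<lambda>i. - i - 1" "\<lambda>i. - i - 1"])
     (auto simp: half_term_reflect[OF assms, symmetric])


text \<open>The factor \<open>\<sigma>\<close> makes up for the exponent \<open>k - 1\<close> in
  \<open>h_sum\<close> against \<open>k\<close> in \<open>alt_t\<close>.\<close>

lemma h_sum_tendsto:
  assumes "\<sigma> \<in> {1, -1}" "r \<ge> 1" "\<not> (r = 1 \<and> \<sigma> = 1)"
  shows "(\<lambda>J. \<sigma> * h_sum r \<sigma> J) \<longlonglongrightarrow> alt_t r \<sigma>"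
proof -
  have "(\<Sum>n<J. \<sigma> ^ Suc n / (real (Suc n) - 1/2) ^ r) = \<sigma> * h_sum r \<sigma> J" for J
    unfolding h_sum_def sum_distrib_left
    by (rule sum.reindex_bij_witness[of _ "\<lambda>k. k - 1" Suc])
       (auto simp: Suc_le_eq of_nat_diff simp flip: power_Suc)
  moreover have "(\<lambda>n. \<sigma> ^ Suc n / (real (Suc n) - 1/2) ^ r) sums alt_t r \<sigma>"
    unfolding alt_t_def if_not_P[OF assms(3)]
    by (intro summable_sums summable_sign_power_series assms) auto
  ultimately show ?thesis by (simp add: sums_def)
qed

lemma half_term_tendsto_0:
  assumes "\<sigma> \<in> {1, -1}" "r \<ge> 1"
  shows "(\<lambda>N. half_term r \<sigma> (int N + c)) \<longlonglongrightarrow> 0"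
proof -
  have "(\<lambda>N. 1 / (real N + (real_of_int c + 1/2))) \<longlonglongrightarrow> 0"
    by real_asymp
  from tendsto_norm[OF tendsto_power[OF this, of r]]
  have "(\<lambda>N. norm ((1 / (real N + (real_of_int c + 1/2))) ^ r)) \<longlonglongrightarrow> 0"
    using assms by (simp add: zero_power)
  moreover have "norm (half_term r \<sigma> (int N + c)) = norm ((1 / (real N + (real_of_int c + 1/2))) ^ r)" for N
    using assms by (auto simp: half_term_def power_divide abs_divide power_int_abs add.assoc)
  ultimately show ?thesis
    using tendsto_norm_zero_iff by fastforce
qed

lemma sum_int_ivl_concat:
  fixes u :: "int \<Rightarrow> 'a :: comm_monoid_add"
  assumes "a \<le> b" "b \<le> c"
  shows "sum u {a..<b} + sum u {b..<c} = sum u {a..<c}"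
  using assms by (subst sum.union_disjoint[symmetric]) (auto intro: sum.cong simp: ivl_disj_un_two)

text \<open>The pairs \<open>n\<close>, \<open>- n\<close> with \<open>1 \<le> n \<le> N\<close>,
  shifted by \<open>c\<close>, fill an interval except for its centre \<open>- c\<close>, which
  stands for \<open>n = 0\<close>.\<close>

lemma sum_symmetric_shift:
  fixes u :: "int \<Rightarrow> 'a :: ab_group_add"
  shows "(\<Sum>n<N. u (int (Suc n) - c) + u (- int (Suc n) - c))
    = sum u {- int N - c..<int N - c + 1} - u (- c)"
proof (induction N)
  case 0
  have "{- c..<1 - c} = {- c}" by auto
  then show ?case by simp
next
  case (Suc N)
  have "sum u {- int (Suc N) - c..<int (Suc N) - c + 1}
     = sum u ({- int N - c..<int N - c + 1} \<union> {int (Suc N) - c, - int (Suc N) - c})"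
    by (rule arg_cong[where f = "sum u"]) auto
  also have "\<dots> = sum u {- int N - c..<int N - c + 1} + (u (int (Suc N) - c) + u (- int (Suc N) - c))"
    by (subst sum.union_disjoint) auto
  finally show ?case using Suc.IH by (simp add: algebra_simps)
qed

text \<open>The interval is centred at \<open>- j\<close>, while the reflection is about
  \<open>- 1/2\<close>. Adding \<open>2 * j - 1\<close> terms at the right end makes it
  reflection-invariant; their number is fixed and each tends to 0.\<close>

lemma half_term_two_sided_tendsto:
  assumes "\<tau> \<in> {1, -1}" "k \<ge> 1" "j \<ge> 1"
  shows "(\<lambda>N. sum (half_term k \<tau>) {- int N - int j..<int N - int j + 1})
    \<longlonglongrightarrow> (\<tau> + (-1) ^ k) * alt_t k \<tau>"
proof -
  have eq: "sum (half_term k \<tau>) {- int N - int j..<int N - int j + 1}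
      = (\<tau> + (-1) ^ k) * (\<tau> * h_sum k \<tau> (N + j)) - (\<Sum>c\<in>{1 - int j..<int j}. half_term k \<tau> (int N + c))"
    for N
  proof -
    have "sum (half_term k \<tau>) {- int (N + j)..<int (N + j)}
        = sum (half_term k \<tau>) {- int (N + j)..<0} + sum (half_term k \<tau>) {0..<int (N + j)}"
      by (subst sum_int_ivl_concat) auto
    also have "\<dots> = (\<tau> + (-1) ^ k) * (\<tau> * h_sum k \<tau> (N + j))"
      unfolding sum_half_term_neg[OF assms(1)] sum_half_term_nonneg
      using assms(1) by (auto simp: algebra_simps)
    finally have "sum (half_term k \<tau>) {- int N - int j..<int N - int j + 1}
       + sum (half_term k \<tau>) {int N - int j + 1..<int N + int j}
       = (\<tau> + (-1) ^ k) * (\<tau> * h_sum k \<tau> (N + j))"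
      using assms(3) by (subst sum_int_ivl_concat) auto
    moreover have "sum (half_term k \<tau>) {int N - int j + 1..<int N + int j}
      = (\<Sum>c\<in>{1 - int j..<int j}. half_term k \<tau> (int N + c))"
      by (rule sum.reindex_bij_witness[of _ "\<lambda>c. int N + c" "\<lambda>i. i - int N"]) auto
    ultimately show ?thesis by (simp add: algebra_simps)
  qed
  have "(\<lambda>N. (\<tau> + (-1) ^ k) * (\<tau> * h_sum k \<tau> (N + j))) \<longlonglongrightarrow> (\<tau> + (-1) ^ k) * alt_t k \<tau>"
  \<comment> \<open>For \<open>k = 1\<close> and \<open>\<tau> = 1\<close> the partial sums diverge,
    but the factor \<open>\<tau> + (-1) ^ k\<close> is 0 and both sides vanish.\<close>
  proof (cases "k = 1 \<and> \<tau> = 1")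
    case False
    then show ?thesis
      using h_sum_tendsto[of \<tau> k] assms
      by (intro tendsto_mult tendsto_const LIMSEQ_ignore_initial_segment) auto
  qed auto
  moreover have "(\<lambda>N. \<Sum>c\<in>{1 - int j..<int j}. half_term k \<tau> (int N + c)) \<longlonglongrightarrow> 0"
    using half_term_tendsto_0[OF assms(1,2)] by (rule tendsto_null_sum)
  ultimately show ?thesis
    unfolding eq using tendsto_diff by fastforce
qed

lemma alt_zeta_sums:
  assumes "\<tau> \<in> {1, -1}" "m \<ge> 1" "\<not> (m = 1 \<and> \<tau> = 1)"
  shows "(\<lambda>n. \<tau> ^ Suc n / real (Suc n) ^ m) sums alt_zeta m \<tau>"
  unfolding alt_zeta_def if_not_P[OF assms(3)]
  using summable_sign_power_series[OF assms(1) _ _ assms(2,3), of 0]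
  by (simp only: diff_zero zero_less_one order_refl summable_sums)

text \<open>The factor is the joint contribution of \<open>n\<close> and \<open>- n\<close>; it
  vanishes for odd \<open>m\<close>, in particular in the divergent case.\<close>

lemma alt_zeta_two_sided_sums:
  assumes "\<tau> \<in> {1, -1}" "m \<ge> 1"
  shows "(\<lambda>n. (1 + (-1) ^ m) * (\<tau> ^ Suc n / real (Suc n) ^ m)) sums ((1 + (-1) ^ m) * alt_zeta m \<tau>)"
proof (cases "m = 1 \<and> \<tau> = 1")
  case False
  then show ?thesis using alt_zeta_sums assms by (intro sums_mult) auto
qed auto

section \<open>A square-root bound, uniform in position\<close>

text \<open>Cauchy-Schwarz against the convergent sum of \<open>1 / (i + 1/2)\<^sup>2\<close> over
  all integers. The bound depends on the size of \<open>I\<close> only and not on its position,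
  which gives a majorant for windows moving to infinity.\<close>

lemma abs_half_term_sum_le:
  assumes "\<sigma> \<in> {1, -1}" "p \<ge> 1"
  shows "\<exists>C\<ge>0. \<forall>I. finite I \<longrightarrow> \<bar>sum (half_term p \<sigma>) I\<bar> \<le> C * sqrt (real (card I))"
proof -
  define K where "K = alt_t 2 1"
  have hK: "h_sum 2 1 n \<le> K" for n
  proof (rule LIMSEQ_le_const)
    show "(\<lambda>J. h_sum 2 1 J) \<longlonglongrightarrow> K"
      using h_sum_tendsto[of 1 2] by (simp add: K_def)
    show "\<exists>N. \<forall>J\<ge>N. h_sum 2 1 n \<le> h_sum 2 1 J"
      by (intro exI[of _ n] allI impI) (auto simp: h_sum_def intro!: sum_mono2)
  qed
  \<comment> \<open>Positive terms allow enlarging \<open>I\<close> to a symmetric interval, whose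
    two halves have equal sums by reflection. Inserting 0 keeps \<open>Max\<close> defined for empty
    \<open>I\<close>.\<close>
  have sq: "(\<Sum>i\<in>I. half_term 2 1 i) \<le> 2 * K" if fin: "finite I" for I
  proof -
    obtain N :: nat where N: "I \<subseteq> {- int N..<int N}"
    proof
      show "I \<subseteq> {- int (nat (Max (abs ` insert 0 I)) + 1)..<int (nat (Max (abs ` insert 0 I)) + 1)}"
      proof
        fix i assume "i \<in> I"
        then have "\<bar>i\<bar> \<le> Max (abs ` insert 0 I)"
          using fin by (intro Max_ge) auto
        then show "i \<in> {- int (nat (Max (abs ` insert 0 I)) + 1)..<int (nat (Max (abs ` insert 0 I)) + 1)}"
          by auto
      qed
    qed
    have "(\<Sum>i\<in>I. half_term 2 1 i) \<le> (\<Sum>i\<in>{- int N..<int N}. half_term 2 1 i)"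
      using N by (intro sum_mono2) (auto simp: half_term_def)
    also have "\<dots> = (\<Sum>i\<in>{- int N..<0}. half_term 2 1 i) + (\<Sum>i\<in>{0..<int N}. half_term 2 1 i)"
      by (subst sum_int_ivl_concat) auto
    also have "\<dots> = 2 * h_sum 2 1 N"
      by (simp add: sum_half_term_neg sum_half_term_nonneg)
    finally show ?thesis using hK[of N] by simp
  qed
  show ?thesis
  proof (intro exI[of _ "2 ^ (p - 1) * sqrt (2 * K)"] conjI allI impI)
    show "0 \<le> 2 ^ (p - 1) * sqrt (2 * K)"
      using hK[of 0] by (simp add: h_sum_def)
    fix I :: "int set" assume I: "finite I"
    define v where "v i = 1 / \<bar>of_int i + 1/2 :: real\<bar>" for i
    have half: "1/2 \<le> \<bar>of_int i + 1/2 :: real\<bar>" for i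
    proof (cases "i \<ge> 0")
      case False
      then have "real_of_int i \<le> -1" by simp
      then show ?thesis by linarith
    qed auto
    have v: "0 \<le> v i" "v i \<le> 2" for i
      using half[of i] by (auto simp: v_def divide_simps)
    \<comment> \<open>As \<open>v i \<le> 2\<close>, all but one of the \<open>p\<close> factors are
      bounded by 2, which reduces to exponent 1.\<close>
    have "\<bar>half_term p \<sigma> i\<bar> \<le> 2 ^ (p - 1) * v i" for i
    proof -
      have "\<bar>half_term p \<sigma> i\<bar> = v i ^ p"
        using assms by (auto simp: half_term_def v_def power_divide power_abs power_int_abs abs_divide)
      also have "\<dots> = v i ^ (p - 1) * v i"
        using assms by (metis One_nat_def Suc_le_D diff_Suc_1 power_Suc2)
      also have "\<dots> \<le> 2 ^ (p - 1) * v i"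
        using v[of i] by (intro mult_right_mono power_mono) auto
      finally show ?thesis .
    qed
    then have "\<bar>sum (half_term p \<sigma>) I\<bar> \<le> (\<Sum>i\<in>I. 2 ^ (p - 1) * v i)"
      by (intro order_trans[OF sum_abs] sum_mono)
    also have "\<dots> = 2 ^ (p - 1) * sum v I" by (simp add: sum_distrib_left)
    also have "sum v I \<le> sqrt (2 * K * real (card I))"
    proof (rule real_le_rsqrt)
      have "(sum v I)\<^sup>2 \<le> (\<Sum>i\<in>I. (v i)\<^sup>2) * real (card I)"
        by (rule sum_squared_le_sum_of_squares)
      also have "(\<Sum>i\<in>I. (v i)\<^sup>2) = (\<Sum>i\<in>I. half_term 2 1 i)"
        by (simp add: v_def half_term_def power_divide)
      also have "\<dots> * real (card I) \<le> 2 * K * real (card I)"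
        by (intro mult_right_mono sq I) auto
      finally show "(sum v I)\<^sup>2 \<le> 2 * K * real (card I)" .
    qed
    finally show "\<bar>sum (half_term p \<sigma>) I\<bar> \<le> 2 ^ (p - 1) * sqrt (2 * K) * sqrt (real (card I))"
      by (simp add: real_sqrt_mult)
  qed
qed


section \<open>Rows: fixed \<open>j\<close>, summation over \<open>n\<close>\<close>

text \<open>Evaluates the term at \<open>n = 0\<close>, which a row leaves out.\<close>

lemma half_term_minus:
  assumes "\<sigma> \<in> {1, -1}" "j \<ge> 1"
  shows "half_term k \<sigma> (- int j) = (-1) ^ k * \<sigma> ^ j / (real j - 1/2) ^ k"
proof -
  have "\<sigma> powi (- int j) = \<sigma> ^ j"
    unfolding sign_powi_minus[OF assms(1)] by simp
  moreover have "(of_int (- int j) + 1/2 :: real) ^ k = (-1) ^ k * (real j - 1/2) ^ k"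
    by (subst power_mult_distrib[symmetric]) (simp add: algebra_simps)
  ultimately show ?thesis by (simp add: half_term_def minus_one_power_iff)
qed

lemma sum_binomial_hockey_stick:
  assumes "p \<ge> 1" "q \<ge> 1"
  shows "(\<Sum>k=1..p. (p + q - k - 1) choose (q - 1)) = (p + q - 1) choose (p - 1)"
proof -
  have "(\<Sum>k=1..p. (p + q - k - 1) choose (q - 1)) = (\<Sum>i\<le>p - 1. (q - 1 + i) choose (q - 1))"
    using assms by (intro sum.reindex_bij_witness[of _ "\<lambda>i. p - i" "\<lambda>k. p - k"]) (auto simp: add.commute)
  also have "\<dots> = (\<Sum>i\<le>p - 1. (q - 1 + i) choose i)"
    by (intro sum.cong refl) (metis add_diff_cancel_left' binomial_symmetric le_add1)
  also have "\<dots> = Suc (q - 1 + (p - 1)) choose (p - 1)"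
    by (rule sum_choose_lower)
  also have "Suc (q - 1 + (p - 1)) = p + q - 1"
    using assms by simp
  finally show ?thesis .
qed

text \<open>Partial fractions with \<open>x = n - b\<close> and \<open>y = n\<close>, so that
  \<open>y - x = b\<close>. Poles in \<open>x\<close> sum to two-sided half-integer sums less their
  term at \<open>n = 0\<close>; poles in \<open>n\<close> sum to zeta values of even order.\<close>

lemma row_sums:
  fixes p q j :: nat and \<sigma>1 \<sigma>2 :: real
  assumes "p \<ge> 1" "q \<ge> 1" "j \<ge> 1" "\<sigma>1 \<in> {1, -1}" "\<sigma>2 \<in> {1, -1}"
  defines "b \<equiv> real j - 1/2" and "\<tau> \<equiv> \<sigma>1 * \<sigma>2"
    and "g \<equiv> \<lambda>n. \<sigma>2 powi n * half_term p \<sigma>1 (n - int j) / of_int n ^ q"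
  shows "(\<lambda>n. g (int (Suc n)) + g (- int (Suc n))) sums
    ((-1) ^ p * ((\<Sum>k=1..p. (1 + (-1) ^ k * \<tau>) * real ((p + q - k - 1) choose (q - 1)) * alt_t k \<tau>
          * (\<sigma>2 ^ j / b ^ (p + q - k)))
        - real ((p + q - 1) choose (p - 1)) * (\<sigma>1 ^ j / b ^ (p + q))
        + (\<Sum>m=1..q. (1 + (-1) ^ m) * real ((p + q - m - 1) choose (p - 1)) * alt_zeta m \<tau>
          * (\<sigma>1 ^ j / b ^ (p + q - m)))))"
proof -
  have \<tau>: "\<tau> \<in> {1, -1}" using assms by auto
  have b: "b > 0" using assms by auto
  define c where "c k = (-1) ^ (p + k) * real ((p + q - k - 1) choose (q - 1)) / b ^ (p + q - k) * \<sigma>2 ^ j" for k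
  define d where "d m = (-1) ^ p * real ((p + q - m - 1) choose (p - 1)) / b ^ (p + q - m) * \<sigma>1 ^ j" for m
  have g: "g n = (\<Sum>k=1..p. c k * half_term k \<tau> (n - int j)) + (\<Sum>m=1..q. d m * (\<tau> powi n / of_int n ^ m))"
    if "n \<noteq> 0" for n
  proof -
    define x :: real where "x = of_int (n - int j) + 1/2"
    have x: "x \<noteq> 0" unfolding x_def by (rule half_int_nonzero)
    \<comment> \<open>The sign is written in the variable of each pole: \<open>n - j\<close> for
      powers of \<open>x\<close>, and \<open>n\<close> for powers of \<open>n\<close>. Both leave
      the same character \<open>\<tau>\<close>.\<close>
    have sgn1: "\<sigma>2 powi n * \<sigma>1 powi (n - int j) = \<sigma>2 ^ j * \<tau> powi (n - int j)"
      and sgn2: "\<sigma>2 powi n * \<sigma>1 powi (n - int j) = \<sigma>1 ^ j * \<tau> powi n"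
      using assms(4,5) by (auto simp: \<tau>_def power_int_diff minus_one_power_iff)
    have "g n = \<sigma>2 powi n * \<sigma>1 powi (n - int j) * (1 / (x ^ p * of_int n ^ q))"
      by (simp add: g_def half_term_def x_def)
    also have "1 / (x ^ p * of_int n ^ q) =
      (\<Sum>k=1..p. (-1) ^ (p + k) * real ((p + q - k - 1) choose (q - 1)) / (b ^ (p + q - k) * x ^ k))
    + (-1) ^ p * (\<Sum>k=1..q. real ((p + q - k - 1) choose (p - 1)) / (b ^ (p + q - k) * of_int n ^ k))"
      using assms(1,2) x b that
      by (intro partial_fraction_two_poles) (auto simp: x_def b_def)
    also have "\<sigma>2 powi n * \<sigma>1 powi (n - int j) * (\<dots>)
      = \<sigma>2 ^ j * \<tau> powi (n - int j) * (\<Sum>k=1..p. (-1) ^ (p + k) * real ((p + q - k - 1) choose (q - 1)) / (b ^ (p + q - k) * x ^ k))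
      + \<sigma>1 ^ j * \<tau> powi n * ((-1) ^ p * (\<Sum>k=1..q. real ((p + q - k - 1) choose (p - 1)) / (b ^ (p + q - k) * of_int n ^ k)))"
      unfolding distrib_left
      by (rule arg_cong2[where f = "(+)", OF arg_cong2[where f = "(*)", OF sgn1 refl]
            arg_cong2[where f = "(*)", OF sgn2 refl]])
    also have "\<dots> = (\<Sum>k=1..p. c k * half_term k \<tau> (n - int j)) + (\<Sum>m=1..q. d m * (\<tau> powi n / of_int n ^ m))"
      unfolding sum_distrib_left
      by (intro arg_cong2[where f = "(+)"] sum.cong refl)
         (simp_all add: c_def d_def half_term_def x_def mult_ac)
    finally show ?thesis .
  qed
  have zeta_pair: "\<tau> powi int (Suc n) / of_int (int (Suc n)) ^ m + \<tau> powi (- int (Suc n)) / of_int (- int (Suc n)) ^ m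
      = (1 + (-1) ^ m) * (\<tau> ^ Suc n / real (Suc n) ^ m)" for n m
  proof -
    have "\<tau> powi (- int (Suc n)) = \<tau> ^ Suc n" "\<tau> powi (int (Suc n)) = \<tau> ^ Suc n"
      unfolding sign_powi_minus[OF \<tau>] by (simp_all only: power_int_of_nat)
    moreover have "(of_int (- int (Suc n)) :: real) ^ m = (-1) ^ m * real (Suc n) ^ m"
      by (subst power_mult_distrib[symmetric]) simp
    ultimately show ?thesis by (simp add: minus_one_power_iff)
  qed
  have "g (int (Suc n)) + g (- int (Suc n))
      = (\<Sum>k=1..p. c k * (half_term k \<tau> (int (Suc n) - int j) + half_term k \<tau> (- int (Suc n) - int j)))
      + (\<Sum>m=1..q. d m * ((1 + (-1) ^ m) * (\<tau> ^ Suc n / real (Suc n) ^ m)))" for n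
    unfolding zeta_pair[symmetric] by (simp add: g distrib_left sum.distrib)
  moreover have "(\<lambda>n. c k * (half_term k \<tau> (int (Suc n) - int j) + half_term k \<tau> (- int (Suc n) - int j)))
      sums (c k * ((\<tau> + (-1) ^ k) * alt_t k \<tau> - half_term k \<tau> (- int j)))" if "k \<ge> 1" for k
    unfolding sums_def sum_distrib_left[symmetric] sum_symmetric_shift
    by (intro tendsto_intros half_term_two_sided_tendsto that \<tau> assms)
  moreover have "(\<lambda>n. d m * ((1 + (-1) ^ m) * (\<tau> ^ Suc n / real (Suc n) ^ m)))
      sums (d m * ((1 + (-1) ^ m) * alt_zeta m \<tau>))" if "m \<ge> 1" for m
    by (intro sums_mult alt_zeta_two_sided_sums that \<tau>)
  ultimately have "(\<lambda>n. g (int (Suc n)) + g (- int (Suc n))) sums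
     ((\<Sum>k=1..p. c k * ((\<tau> + (-1) ^ k) * alt_t k \<tau> - half_term k \<tau> (- int j)))
      + (\<Sum>m=1..q. d m * ((1 + (-1) ^ m) * alt_zeta m \<tau>)))"
    by (simp only:) (intro sums_add sums_sum; simp)
  \<comment> \<open>In the terms for \<open>n = 0\<close> the powers of \<open>b\<close> combine to
    \<open>b ^ (p + q)\<close> for every \<open>k\<close>, so only their binomial coefficients
    remain to be added, by the hockey-stick identity.\<close>
  also have "(\<Sum>k=1..p. c k * ((\<tau> + (-1) ^ k) * alt_t k \<tau> - half_term k \<tau> (- int j)))
     = (-1) ^ p * (\<Sum>k=1..p. (1 + (-1) ^ k * \<tau>) * real ((p + q - k - 1) choose (q - 1)) * alt_t k \<tau>
          * (\<sigma>2 ^ j / b ^ (p + q - k)))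
       - (-1) ^ p * (\<Sum>k=1..p. real ((p + q - k - 1) choose (q - 1))) * (\<sigma>1 ^ j / b ^ (p + q))"
    unfolding sum_distrib_left sum_distrib_right sum_subtractf[symmetric]
  proof (intro sum.cong refl)
    fix k assume k: "k \<in> {1..p}"
    have sgn: "\<sigma>2 ^ j * \<tau> ^ j = \<sigma>1 ^ j"
      using assms(5) by (auto simp: \<tau>_def power_mult_distrib)
    have "c k * ((\<tau> + (-1) ^ k) * alt_t k \<tau>)
        = ((-1) ^ (p + k) * (\<tau> + (-1) ^ k)) * (real ((p + q - k - 1) choose (q - 1)) * alt_t k \<tau>
          * (\<sigma>2 ^ j / b ^ (p + q - k)))"
      by (simp add: c_def)
    also have "(-1) ^ (p + k) * (\<tau> + (-1) ^ k) = (-1) ^ p * (1 + (-1) ^ k * \<tau>)"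
      by (simp add: minus_one_power_iff)
    finally have "c k * ((\<tau> + (-1) ^ k) * alt_t k \<tau>) = (-1) ^ p * ((1 + (-1) ^ k * \<tau>) * real ((p + q - k - 1) choose (q - 1)) * alt_t k \<tau>
          * (\<sigma>2 ^ j / b ^ (p + q - k)))"
      by (simp only: mult.assoc)
    moreover have "c k * half_term k \<tau> (- int j)
        = (-1) ^ p * real ((p + q - k - 1) choose (q - 1)) * (\<sigma>1 ^ j / b ^ (p + q))"
    proof -
      have "b ^ (p + q) = b ^ (p + q - k) * b ^ k" using k by (simp flip: power_add)
      moreover have "(-1 :: real) ^ (p + k) * (-1) ^ k = (-1) ^ p" by (simp add: minus_one_power_iff)
      moreover have "half_term k \<tau> (- int j) = (-1) ^ k * \<tau> ^ j / b ^ k"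
        using half_term_minus[OF \<tau> assms(3)] by (simp add: b_def)
      moreover have "c k * ((-1) ^ k * \<tau> ^ j / b ^ k)
        = ((-1) ^ (p + k) * (-1) ^ k) * real ((p + q - k - 1) choose (q - 1)) * ((\<sigma>2 ^ j * \<tau> ^ j) / (b ^ (p + q - k) * b ^ k))"
        by (simp add: c_def mult_ac)
      ultimately show ?thesis by (simp only: sgn)
    qed
    ultimately show "c k * ((\<tau> + (-1) ^ k) * alt_t k \<tau> - half_term k \<tau> (- int j))
       = (-1) ^ p * ((1 + (-1) ^ k * \<tau>) * real ((p + q - k - 1) choose (q - 1)) * alt_t k \<tau>
          * (\<sigma>2 ^ j / b ^ (p + q - k)))
       - (-1) ^ p * real ((p + q - k - 1) choose (q - 1)) * (\<sigma>1 ^ j / b ^ (p + q))"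
      by (simp only: right_diff_distrib)
  qed
  also have "(\<Sum>k=1..p. real ((p + q - k - 1) choose (q - 1))) = real ((p + q - 1) choose (p - 1))"
    unfolding sum_binomial_hockey_stick[OF assms(1,2), symmetric] by simp
  also have "(\<Sum>m=1..q. d m * ((1 + (-1) ^ m) * alt_zeta m \<tau>)) =
     (-1) ^ p * (\<Sum>m=1..q. (1 + (-1) ^ m) * real ((p + q - m - 1) choose (p - 1)) * alt_zeta m \<tau>
          * (\<sigma>1 ^ j / b ^ (p + q - m)))"
    unfolding sum_distrib_left by (intro sum.cong refl) (simp add: d_def mult_ac)
  finally show ?thesis by (simp add: algebra_simps)
qed

section \<open>Columns: fixed \<open>n\<close>, summation over \<open>j\<close>\<close>

text \<open>The indices \<open>n - j\<close> and \<open>- n - j\<close> run through two blocks of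
  \<open>J\<close> consecutive integers. Both are compared with \<open>{- J..<0}\<close>: they
  differ from it by \<open>n\<close> terms next to 0, giving \<open>h_sum p \<sigma>1 n\<close>, and
  by \<open>n\<close> terms next to \<open>- J\<close>, the windows.\<close>

lemma column_sum:
  fixes p q J n :: nat and \<sigma>1 \<sigma>2 :: real
  assumes "\<sigma>1 \<in> {1, -1}" "\<sigma>2 \<in> {1, -1}" "n \<ge> 1"
  defines "g \<equiv> \<lambda>j n. \<sigma>2 powi n * half_term p \<sigma>1 (n - int j) / of_int n ^ q"
  shows "(\<Sum>j=1..J. g j (int n) + g j (- int n)) = \<sigma>2 ^ n / real n ^ q *
     ((1 + (-1) ^ q) * ((-1) ^ p * \<sigma>1 * h_sum p \<sigma>1 J) + (1 - (-1) ^ (p + q) * \<sigma>1) * h_sum p \<sigma>1 n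
      + ((-1) ^ q * sum (half_term p \<sigma>1) {- int n - int J..<- int J}
         - sum (half_term p \<sigma>1) {- int J..<int n - int J}))"
proof -
  let ?S = "sum (half_term p \<sigma>1)"
  have shift: "(\<Sum>j=1..J. half_term p \<sigma>1 (m - int j)) = ?S {m - int J..<m}" for m
    by (rule sum.reindex_bij_witness[of _ "\<lambda>i. nat (m - i)" "\<lambda>j. m - int j"]) auto
  have W: "?S {- int J..<0} = (-1) ^ p * \<sigma>1 * h_sum p \<sigma>1 J"
    by (rule sum_half_term_neg[OF assms(1)])
  \<comment> \<open>The same interval is cut at \<open>n - J\<close> and at 0; for negative
    \<open>n\<close> below, at \<open>- n\<close> and at \<open>- J\<close>.\<close>
  have "?S {- int J..<int n - int J} + ?S {int n - int J..<int n} = ?S {- int J..<0} + ?S {0..<int n}"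
    by (simp add: sum_int_ivl_concat)
  then have pos: "?S {int n - int J..<int n}
     = (-1) ^ p * \<sigma>1 * h_sum p \<sigma>1 J + h_sum p \<sigma>1 n - ?S {- int J..<int n - int J}"
    unfolding W sum_half_term_nonneg by linarith
  have "?S {- int n - int J..<- int n} + ?S {- int n..<0} = ?S {- int n - int J..<- int J} + ?S {- int J..<0}"
    by (simp add: sum_int_ivl_concat)
  then have neg: "?S {- int n - int J..<- int n}
     = (-1) ^ p * \<sigma>1 * h_sum p \<sigma>1 J - (-1) ^ p * \<sigma>1 * h_sum p \<sigma>1 n + ?S {- int n - int J..<- int J}"
    unfolding W sum_half_term_neg[OF assms(1)] by linarith
  have sgn: "\<sigma>2 powi (- int n) = \<sigma>2 ^ n" "\<sigma>2 powi (int n) = \<sigma>2 ^ n"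
    unfolding sign_powi_minus[OF assms(2)] by simp_all
  have pw: "(of_int (- int n) :: real) ^ q = (-1) ^ q * real n ^ q"
    by (subst power_mult_distrib[symmetric]) simp
  have "(\<Sum>j=1..J. g j (int n) + g j (- int n))
     = \<sigma>2 ^ n / real n ^ q * ?S {int n - int J..<int n}
      + \<sigma>2 ^ n / ((-1) ^ q * real n ^ q) * ?S {- int n - int J..<- int n}"
    unfolding g_def sum.distrib sgn pw shift[symmetric]
    by (simp add: sum_distrib_left)
  also have "\<dots> = \<sigma>2 ^ n / real n ^ q * (?S {int n - int J..<int n} + (-1) ^ q * ?S {- int n - int J..<- int n})"
    by (simp add: minus_one_power_iff algebra_simps)
  also have "?S {int n - int J..<int n} + (-1) ^ q * ?S {- int n - int J..<- int n}
     = (1 + (-1) ^ q) * ((-1) ^ p * \<sigma>1 * h_sum p \<sigma>1 J) + (1 - (-1) ^ (p + q) * \<sigma>1) * h_sum p \<sigma>1 n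
      + ((-1) ^ q * ?S {- int n - int J..<- int J} - ?S {- int J..<int n - int J})"
    unfolding pos neg by (cases "even p"; cases "even q") (simp_all add: algebra_simps)
  finally show ?thesis .
qed


section \<open>Vanishing of the windows and convergence of the Euler sum\<close>

lemma half_term_window_tendsto_0:
  assumes "\<sigma> \<in> {1, -1}" "p \<ge> 1"
  shows "(\<lambda>J. sum (half_term p \<sigma>) {a - int J..<b - int J}) \<longlonglongrightarrow> 0"
proof -
  have "sum (half_term p \<sigma>) {a - int J..<b - int J}
      = (\<Sum>c\<in>{a..<b}. (-1) ^ p * \<sigma> * half_term p \<sigma> (int J + (- c - 1)))" for J
    by (rule sum.reindex_bij_witness[of _ "\<lambda>c. c - int J" "\<lambda>i. i + int J"])
       (auto simp: half_term_reflect[OF assms(1), symmetric])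
  moreover have "(\<lambda>J. \<Sum>c\<in>{a..<b}. (-1) ^ p * \<sigma> * half_term p \<sigma> (int J + (- c - 1))) \<longlonglongrightarrow> 0"
    by (intro tendsto_null_sum tendsto_mult_right_zero half_term_tendsto_0 assms)
  ultimately show ?thesis by simp
qed

lemma summable_powr_three_halves: "summable (\<lambda>n. C * real (Suc n) powr (- 3/2))"
proof -
  have "summable (\<lambda>n. real n powr (- 3/2))"
    by (subst summable_real_powr_iff) auto
  then have "summable (\<lambda>n. real (Suc n) powr (- 3/2))"
    by (subst summable_Suc_iff)
  then show ?thesis by (rule summable_mult)
qed

text \<open>With \<open>q \<ge> 2\<close> a square-root bound on \<open>x\<close> leaves the
  summable majorant with exponent \<open>- 3/2\<close>.\<close>

lemma norm_weighted_le:
  assumes "\<sigma> \<in> {1, -1}" "q \<ge> 2" "\<bar>x\<bar> \<le> C * sqrt (real (Suc n))" "C \<ge> 0"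
  shows "norm (\<sigma> ^ Suc n / real (Suc n) ^ q * x) \<le> C * real (Suc n) powr (- 3/2)"
proof -
  have \<sigma>: "\<bar>\<sigma> ^ Suc n\<bar> = 1" using assms by (auto simp: power_abs)
  have "norm (\<sigma> ^ Suc n / real (Suc n) ^ q * x) = \<bar>x\<bar> / real (Suc n) ^ q"
    unfolding real_norm_def abs_mult abs_divide \<sigma> by simp
  also have "\<dots> \<le> C * sqrt (real (Suc n)) / real (Suc n) ^ 2"
    using assms by (intro frac_le power_increasing) auto
  also have "\<dots> = C * (sqrt (real (Suc n)) / real (Suc n) ^ 2)"
    by simp
  also have "sqrt (real (Suc n)) / real (Suc n) ^ 2 = real (Suc n) powr (1/2) / real (Suc n) powr 2"
    by (simp add: powr_half_sqrt)
  also have "\<dots> = real (Suc n) powr (- 3/2)"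
    by (subst powr_diff[symmetric]) simp
  finally show ?thesis .
qed

text \<open>For each \<open>n\<close> both windows have fixed length and move to minus infinity, so
  \<open>E n J\<close> tends to 0; the majorant is free of \<open>J\<close>, so Tannery's theorem
  permits the limit under the sum.\<close>

lemma error_tendsto_0:
  fixes p q :: nat and \<sigma>1 \<sigma>2 :: real
  assumes "p \<ge> 1" "q \<ge> 2" "\<sigma>1 \<in> {1, -1}" "\<sigma>2 \<in> {1, -1}"
  defines "E \<equiv> \<lambda>n J. \<sigma>2 ^ Suc n / real (Suc n) ^ q *
    ((-1) ^ q * sum (half_term p \<sigma>1) {- int (Suc n) - int J..<- int J}
      - sum (half_term p \<sigma>1) {- int J..<int (Suc n) - int J})"
  shows "summable (\<lambda>n. E n J)" "(\<lambda>J. \<Sum>n. E n J) \<longlonglongrightarrow> 0"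
proof -
  obtain C where C: "C \<ge> 0" "\<And>I. finite I \<Longrightarrow> \<bar>sum (half_term p \<sigma>1) I\<bar> \<le> C * sqrt (real (card I))"
    using abs_half_term_sum_le[OF assms(3,1)] by blast
  have bound: "norm (E n J) \<le> 2 * C * real (Suc n) powr (- 3/2)" for n J
    unfolding E_def
  proof (rule norm_weighted_le)
    let ?A = "sum (half_term p \<sigma>1) {- int (Suc n) - int J..<- int J}"
    let ?B = "sum (half_term p \<sigma>1) {- int J..<int (Suc n) - int J}"
    have "\<bar>?A\<bar> \<le> C * sqrt (real (Suc n))" "\<bar>?B\<bar> \<le> C * sqrt (real (Suc n))"
      using C(2)[of "{- int (Suc n) - int J..<- int J}"] C(2)[of "{- int J..<int (Suc n) - int J}"]
      by (simp_all add: nat_add_distrib)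
    moreover have "\<bar>(-1) ^ q * ?A - ?B\<bar> \<le> \<bar>?A\<bar> + \<bar>?B\<bar>"
      by (auto simp: minus_one_power_iff)
    ultimately show "\<bar>(-1) ^ q * ?A - ?B\<bar> \<le> 2 * C * sqrt (real (Suc n))"
      by linarith
  qed (use assms C in auto)
  show "summable (\<lambda>n. E n J)"
    by (rule summable_comparison_test'[OF summable_powr_three_halves bound])
  have "(\<lambda>J. E n J) \<longlonglongrightarrow> 0" for n
  proof -
    have "(\<lambda>J. sum (half_term p \<sigma>1) {- int (Suc n) - int J..<- int J}) \<longlonglongrightarrow> 0"
      "(\<lambda>J. sum (half_term p \<sigma>1) {- int J..<int (Suc n) - int J}) \<longlonglongrightarrow> 0"
      using half_term_window_tendsto_0[OF assms(3,1), of "- int (Suc n)" 0]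
        half_term_window_tendsto_0[OF assms(3,1), of 0 "int (Suc n)"] by simp_all
    then have "(\<lambda>J. E n J) \<longlonglongrightarrow> \<sigma>2 ^ Suc n / real (Suc n) ^ q * ((-1) ^ q * 0 - 0)"
      unfolding E_def by (intro tendsto_intros)
    then show ?thesis by simp
  qed
  from tannerys_theorem[OF this _ summable_powr_three_halves[of "2 * C"]]
  have "(\<lambda>J. \<Sum>n. E n J) \<longlonglongrightarrow> (\<Sum>n. 0)"
    using bound by (simp add: always_eventually)
  then show "(\<lambda>J. \<Sum>n. E n J) \<longlonglongrightarrow> 0" by simp
qed

text \<open>\<open>h_sum\<close> is itself a sum of half-integer terms over an interval, so the
  square-root bound covers it even where it is unbounded. The factor \<open>\<sigma>2\<close> raises
  the exponent \<open>m - 1\<close> in \<open>euler_S\<close> to \<open>m\<close>.\<close>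

lemma euler_S_sums:
  assumes "p \<ge> 1" "q \<ge> 2" "\<sigma>1 \<in> {1, -1}" "\<sigma>2 \<in> {1, -1}"
  shows "(\<lambda>n. \<sigma>2 ^ Suc n / real (Suc n) ^ q * h_sum p \<sigma>1 (Suc n)) sums (\<sigma>2 * euler_S p q \<sigma>1 \<sigma>2)"
proof -
  obtain C where C: "C \<ge> 0" "\<And>I. finite I \<Longrightarrow> \<bar>sum (half_term p \<sigma>1) I\<bar> \<le> C * sqrt (real (card I))"
    using abs_half_term_sum_le[OF assms(3,1)] by blast
  have bound: "\<bar>h_sum p \<sigma>1 (Suc n)\<bar> \<le> C * sqrt (real (Suc n))" for n
    using C(2)[of "{0..<int (Suc n)}"] unfolding sum_half_term_nonneg by simp
  have "summable (\<lambda>n. \<sigma>2 ^ Suc n / real (Suc n) ^ q * h_sum p \<sigma>1 (Suc n))"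
    by (rule summable_comparison_test'[OF summable_powr_three_halves norm_weighted_le[OF assms(4,2) bound C(1)]])
  then have "summable (\<lambda>n. \<sigma>2 * (\<sigma>2 ^ Suc n / real (Suc n) ^ q * h_sum p \<sigma>1 (Suc n)))"
    by (rule summable_mult)
  moreover have eq: "\<sigma>2 * (\<sigma>2 ^ Suc n / real (Suc n) ^ q * h_sum p \<sigma>1 (Suc n))
      = \<sigma>2 ^ n * (h_sum p \<sigma>1 (Suc n) / real (Suc n) ^ q)" for n
    using assms(4) by auto
  ultimately have "(\<lambda>n. \<sigma>2 ^ n * (h_sum p \<sigma>1 (Suc n) / real (Suc n) ^ q)) sums euler_S p q \<sigma>1 \<sigma>2"
    unfolding euler_S_def by (simp only: eq summable_sums)
  from sums_mult[OF this, of \<sigma>2] show ?thesis by (simp add: mult_ac)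
qed

section \<open>Finitely many rows summed in two ways\<close>

lemma sum_even_indices:
  fixes f :: "nat \<Rightarrow> real"
  shows "(\<Sum>m=1..q. (1 + (-1) ^ m) * f m) = 2 * (\<Sum>j=1..q div 2. f (2 * j))"
proof (induction q)
  case (Suc q)
  show ?case
  proof (cases "even (Suc q)")
    case True
    then have "Suc q div 2 = Suc (q div 2)" "2 * Suc (q div 2) = Suc q" by presburger+
    then have "(\<Sum>j=1..Suc q div 2. f (2 * j)) = (\<Sum>j=1..q div 2. f (2 * j)) + f (Suc q)"
      by simp
    then show ?thesis using Suc True by (simp add: algebra_simps)
  next
    case False
    then have "Suc q div 2 = q div 2" by presburger
    then show ?thesis using Suc False by simp
  qed
qed simp

lemma sum_signed_half_powers: "(\<Sum>j=1..J. \<sigma> ^ j / (real j - 1/2) ^ r) = \<sigma> * h_sum r \<sigma> J"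
  unfolding h_sum_def sum_distrib_left
  by (intro sum.cong refl) (auto simp: power_eq_if)

lemma sum_linear_combination:
  fixes s c :: "'a :: comm_ring_1"
  shows "(\<Sum>j\<in>A. s * ((\<Sum>k\<in>B. a k * x j k) - c * y j + (\<Sum>m\<in>D. d m * z j m)))
    = s * ((\<Sum>k\<in>B. a k * (\<Sum>j\<in>A. x j k)) - c * (\<Sum>j\<in>A. y j) + (\<Sum>m\<in>D. d m * (\<Sum>j\<in>A. z j m)))"
proof -
  have "(\<Sum>j\<in>A. \<Sum>k\<in>B. a k * x j k) = (\<Sum>k\<in>B. a k * (\<Sum>j\<in>A. x j k))"
    "(\<Sum>j\<in>A. \<Sum>m\<in>D. d m * z j m) = (\<Sum>m\<in>D. d m * (\<Sum>j\<in>A. z j m))"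
    by (subst sum.swap, simp add: sum_distrib_left)+
  then show ?thesis
    by (simp add: sum.distrib sum_subtractf flip: sum_distrib_left)
qed

text \<open>The first \<open>J\<close> rows form one series in \<open>n\<close> of finite sums over
  \<open>j\<close>. Adding the row values gives the right side, evaluating each column first gives
  the left side, and a convergent series has only one sum.\<close>

lemma truncated_identity:
  fixes p q J :: nat and \<sigma>1 \<sigma>2 :: real
  assumes "p \<ge> 1" "q \<ge> 2" "\<sigma>1 \<in> {1, -1}" "\<sigma>2 \<in> {1, -1}"
  defines "\<tau> \<equiv> \<sigma>1 * \<sigma>2"
  defines "E \<equiv> \<lambda>n J. \<sigma>2 ^ Suc n / real (Suc n) ^ q *
    ((-1) ^ q * sum (half_term p \<sigma>1) {- int (Suc n) - int J..<- int J}
      - sum (half_term p \<sigma>1) {- int J..<int (Suc n) - int J})"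
  shows "(1 + (-1) ^ q) * ((-1) ^ p * (\<sigma>1 * h_sum p \<sigma>1 J)) * alt_zeta q \<sigma>2
      + (1 - (-1) ^ (p + q) * \<sigma>1) * (\<sigma>2 * euler_S p q \<sigma>1 \<sigma>2) + (\<Sum>n. E n J)
    = (-1) ^ p * ((\<Sum>k=1..p. (1 + (-1) ^ k * \<tau>) * real ((p + q - k - 1) choose (q - 1)) * alt_t k \<tau>
          * (\<sigma>2 * h_sum (p + q - k) \<sigma>2 J))
        - real ((p + q - 1) choose (p - 1)) * (\<sigma>1 * h_sum (p + q) \<sigma>1 J)
        + (\<Sum>m=1..q. (1 + (-1) ^ m) * real ((p + q - m - 1) choose (p - 1)) * alt_zeta m \<tau>
          * (\<sigma>1 * h_sum (p + q - m) \<sigma>1 J)))"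
proof -
  define g where "g j n = \<sigma>2 powi n * half_term p \<sigma>1 (n - int j) / of_int n ^ q" for j :: nat and n
  let ?R = "\<lambda>j. (-1) ^ p * ((\<Sum>k=1..p. (1 + (-1) ^ k * \<tau>) * real ((p + q - k - 1) choose (q - 1)) * alt_t k \<tau>
          * (\<sigma>2 ^ j / (real j - 1/2) ^ (p + q - k)))
        - real ((p + q - 1) choose (p - 1)) * (\<sigma>1 ^ j / (real j - 1/2) ^ (p + q))
        + (\<Sum>m=1..q. (1 + (-1) ^ m) * real ((p + q - m - 1) choose (p - 1)) * alt_zeta m \<tau>
          * (\<sigma>1 ^ j / (real j - 1/2) ^ (p + q - m))))"
  have rows: "(\<lambda>n. \<Sum>j=1..J. g j (int (Suc n)) + g j (- int (Suc n))) sums (\<Sum>j=1..J. ?R j)"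
    using assms unfolding g_def \<tau>_def by (intro sums_sum row_sums) auto
  have columns: "(\<lambda>n. \<Sum>j=1..J. g j (int (Suc n)) + g j (- int (Suc n))) sums
     ((1 + (-1) ^ q) * ((-1) ^ p * (\<sigma>1 * h_sum p \<sigma>1 J)) * alt_zeta q \<sigma>2
      + (1 - (-1) ^ (p + q) * \<sigma>1) * (\<sigma>2 * euler_S p q \<sigma>1 \<sigma>2) + (\<Sum>n. E n J))"
  proof -
    have "(\<Sum>j=1..J. g j (int (Suc n)) + g j (- int (Suc n)))
      = (1 + (-1) ^ q) * ((-1) ^ p * (\<sigma>1 * h_sum p \<sigma>1 J)) * (\<sigma>2 ^ Suc n / real (Suc n) ^ q)
       + (1 - (-1) ^ (p + q) * \<sigma>1) * (\<sigma>2 ^ Suc n / real (Suc n) ^ q * h_sum p \<sigma>1 (Suc n)) + E n J" for n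
      using column_sum[OF assms(3,4), of "Suc n" p q J] unfolding g_def E_def
      by (simp only: le_add1 plus_1_eq_Suc distrib_left mult_ac)
    moreover have "(\<lambda>n. E n J) sums (\<Sum>n. E n J)"
      unfolding E_def by (intro summable_sums error_tendsto_0(1) assms)
    moreover have "(\<lambda>n. \<sigma>2 ^ Suc n / real (Suc n) ^ q) sums alt_zeta q \<sigma>2"
      using assms by (intro alt_zeta_sums) auto
    ultimately show ?thesis
      by (simp only:) (intro sums_add sums_mult euler_S_sums assms)
  qed
  have "(1 + (-1) ^ q) * ((-1) ^ p * (\<sigma>1 * h_sum p \<sigma>1 J)) * alt_zeta q \<sigma>2
      + (1 - (-1) ^ (p + q) * \<sigma>1) * (\<sigma>2 * euler_S p q \<sigma>1 \<sigma>2) + (\<Sum>n. E n J) = (\<Sum>j=1..J. ?R j)"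
    by (rule sums_unique2[OF columns rows])
  also have "\<dots> = (-1) ^ p * ((\<Sum>k=1..p. (1 + (-1) ^ k * \<tau>) * real ((p + q - k - 1) choose (q - 1)) * alt_t k \<tau>
          * (\<Sum>j=1..J. \<sigma>2 ^ j / (real j - 1/2) ^ (p + q - k)))
        - real ((p + q - 1) choose (p - 1)) * (\<Sum>j=1..J. \<sigma>1 ^ j / (real j - 1/2) ^ (p + q))
        + (\<Sum>m=1..q. (1 + (-1) ^ m) * real ((p + q - m - 1) choose (p - 1)) * alt_zeta m \<tau>
          * (\<Sum>j=1..J. \<sigma>1 ^ j / (real j - 1/2) ^ (p + q - m))))"
    by (rule sum_linear_combination)
  finally show ?thesis unfolding sum_signed_half_powers .
qed

section \<open>The limit of infinitely many rows\<close>

theorem theorem3p7: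
  fixes p q :: nat and \<sigma>1 \<sigma>2 :: real
  assumes "p \<ge> 1" and "q \<ge> 2"
    and "\<sigma>1 \<in> {1, -1}" and "\<sigma>2 \<in> {1, -1}"
  shows "\<sigma>2 * (-1) ^ p * delta_coeff \<sigma>1 (int (p + q)) * euler_S p q \<sigma>1 \<sigma>2
    = - (1 + (-1) ^ q) * alt_t p \<sigma>1 * alt_zeta q \<sigma>2
      - real ((p + q - 1) choose (p - 1)) * alt_t (p + q) \<sigma>1
      + (\<Sum>k=1..p. delta_coeff (\<sigma>1 * \<sigma>2) (int k - 1) * real ((p + q - k - 1) choose (q - 1))
            * alt_t (p + q - k) \<sigma>2 * alt_t k (\<sigma>1 * \<sigma>2))
      + 2 * (\<Sum>j=1..q div 2. real ((p + q - 2 * j - 1) choose (p - 1))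
            * alt_t (p + q - 2 * j) \<sigma>1 * alt_zeta (2 * j) (\<sigma>1 * \<sigma>2))"
proof -
  define \<tau> where "\<tau> = \<sigma>1 * \<sigma>2"
  define e where "e J = (\<Sum>n. \<sigma>2 ^ Suc n / real (Suc n) ^ q *
    ((-1) ^ q * sum (half_term p \<sigma>1) {- int (Suc n) - int J..<- int J}
      - sum (half_term p \<sigma>1) {- int J..<int (Suc n) - int J}))" for J
  define a where "a k = (1 + (-1) ^ k * \<tau>) * real ((p + q - k - 1) choose (q - 1)) * alt_t k \<tau>" for k
  define d where "d m = (1 + (-1) ^ m) * real ((p + q - m - 1) choose (p - 1)) * alt_zeta m \<tau>" for m
  define c where "c = real ((p + q - 1) choose (p - 1))"
  define S where "S = (1 - (-1) ^ (p + q) * \<sigma>1) * (\<sigma>2 * euler_S p q \<sigma>1 \<sigma>2)"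
  \<comment> \<open>Collects the coefficients of \<open>\<sigma>1 * h_sum p \<sigma>1 J\<close>,
    coming from the columns and from \<open>m = q\<close> in the rows. All other orders,
    \<open>p + q - k\<close> with \<open>k \<le> p\<close> and \<open>p + q - m\<close> with
    \<open>m < q\<close>, are at least 2, so those sums converge.\<close>
  define v where "v = (1 + (-1) ^ q) * (alt_zeta q \<tau> - alt_zeta q \<sigma>2)"
  have dq: "d q = (1 + (-1) ^ q) * alt_zeta q \<tau>" using assms by (simp add: d_def)
  have split_q: "(\<Sum>m=1..q. F m) = (\<Sum>m\<in>{1..<q}. F m) + F q" for F :: "nat \<Rightarrow> real"
    using assms by (simp add: sum.last_plus add.commute)
  define u where "u J = v * (\<sigma>1 * h_sum p \<sigma>1 J)" for J
  let ?F = "\<lambda>T2 T1 T0. (-1) ^ p * ((\<Sum>k=1..p. a k * T2 (p + q - k)) - c * T1 (p + q)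
      + (\<Sum>m\<in>{1..<q}. d m * T1 (p + q - m)) + T0)"
  \<comment> \<open>The left side is free of \<open>J\<close>, so it equals the limit of the right
    side.\<close>
  have S_eq: "S = ?F (\<lambda>r. \<sigma>2 * h_sum r \<sigma>2 J) (\<lambda>r. \<sigma>1 * h_sum r \<sigma>1 J) (u J) - e J" for J
    using truncated_identity[OF assms, of J]
    unfolding \<tau>_def[symmetric] e_def[symmetric] a_def[symmetric] d_def[symmetric] c_def[symmetric] S_def[symmetric]
      split_q dq v_def u_def
    by (simp add: algebra_simps)
  have "(\<lambda>J. v * (\<sigma>1 * h_sum p \<sigma>1 J)) \<longlonglongrightarrow> v * alt_t p \<sigma>1"
  proof (cases "p = 1 \<and> \<sigma>1 = 1")
    case True
    \<comment> \<open>For \<open>\<sigma>1 = 1\<close> the product \<open>\<tau>\<close> is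
      \<open>\<sigma>2\<close>, and the two zeta values cancel.\<close>
    then have "v = 0" by (simp add: v_def \<tau>_def)
    then show ?thesis by simp
  next
    case False
    then show ?thesis using assms by (intro tendsto_mult tendsto_const h_sum_tendsto) auto
  qed
  then have "u \<longlonglongrightarrow> v * alt_t p \<sigma>1"
    by (simp only: u_def[abs_def])
  moreover have "e \<longlonglongrightarrow> 0"
    unfolding e_def[abs_def] by (rule error_tendsto_0(2)[OF assms])
  ultimately have "(\<lambda>J. ?F (\<lambda>r. \<sigma>2 * h_sum r \<sigma>2 J) (\<lambda>r. \<sigma>1 * h_sum r \<sigma>1 J) (u J) - e J)
      \<longlonglongrightarrow> ?F (\<lambda>r. alt_t r \<sigma>2) (\<lambda>r. alt_t r \<sigma>1) (v * alt_t p \<sigma>1) - 0"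
    using assms by (intro tendsto_intros h_sum_tendsto) auto
  then have "S = ?F (\<lambda>r. alt_t r \<sigma>2) (\<lambda>r. alt_t r \<sigma>1) (v * alt_t p \<sigma>1)"
    by (simp only: S_eq[symmetric] LIMSEQ_const_iff diff_zero)
  then have "(-1) ^ p * S = (\<Sum>k=1..p. a k * alt_t (p + q - k) \<sigma>2) - c * alt_t (p + q) \<sigma>1
      + (\<Sum>m\<in>{1..<q}. d m * alt_t (p + q - m) \<sigma>1) + v * alt_t p \<sigma>1"
    by simp
  \<comment> \<open>The two parts of \<open>v\<close> separate again: one restores the summand
    \<open>m = q\<close>, the other is the product term of the claim.\<close>
  also have "\<dots> = (\<Sum>k=1..p. a k * alt_t (p + q - k) \<sigma>2) - c * alt_t (p + q) \<sigma>1
      + (\<Sum>m=1..q. d m * alt_t (p + q - m) \<sigma>1) - (1 + (-1) ^ q) * alt_t p \<sigma>1 * alt_zeta q \<sigma>2"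
    unfolding split_q dq v_def by (simp add: algebra_simps)
  also have "(\<Sum>m=1..q. d m * alt_t (p + q - m) \<sigma>1)
     = 2 * (\<Sum>j=1..q div 2. real ((p + q - 2 * j - 1) choose (p - 1))
            * alt_t (p + q - 2 * j) \<sigma>1 * alt_zeta (2 * j) \<tau>)"
    unfolding sum_even_indices[of "\<lambda>m. real ((p + q - m - 1) choose (p - 1))
        * alt_t (p + q - m) \<sigma>1 * alt_zeta m \<tau>", symmetric]
    by (intro sum.cong refl) (simp add: d_def mult_ac)
  also have "(\<Sum>k=1..p. a k * alt_t (p + q - k) \<sigma>2)
     = (\<Sum>k=1..p. delta_coeff \<tau> (int k - 1) * real ((p + q - k - 1) choose (q - 1))
            * alt_t (p + q - k) \<sigma>2 * alt_t k \<tau>)"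
    by (intro sum.cong refl) (auto simp: a_def delta_coeff_def power_int_diff mult_ac)
  also have "(-1) ^ p * S = \<sigma>2 * (-1) ^ p * delta_coeff \<sigma>1 (int (p + q)) * euler_S p q \<sigma>1 \<sigma>2"
    unfolding S_def delta_coeff_def power_int_of_nat by (simp add: mult_ac)
  finally show ?thesis
    unfolding \<tau>_def c_def by (simp add: algebra_simps)
qed

end
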